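(* Let $d\ge 1$ and let $\mathbb{B}_1$ be the open unit ball of $\mathbb{R}^d$. Consider two second-order elliptic operators $$\mathcal{L}_i w := \sum_{j,k=1}^d a_i^{jk}(x)\,\partial_j\partial_k w + \sum_{j=1}^d b_i^j(x)\,\partial_j w + c_i(x)\, w, \qquad x\in\mathbb{B}_1,\quad i=1,2,$$ where $a_i^{jk}=a_i^{kj}$, $b_i^j$, and $c_i$, $i=1,2$, $1\le j,k\le d$, are bounded functions in $\mathbb{B}_1$ satisfying, for some $\eta>0$ and $i=1,2$, $$\sum_{j,k=1}^d a_i^{jk}(x)\,\xi_j\xi_k\ge \eta|\xi|^2 \quad\text{and}\quad c_i(x)\le 0, \qquad (x,\xi)\in\mathbb{B}_1\times\mathbb{R}^d.$$ Let $(u,\gamma)$ be a pair of functions with $u\in C^4(\mathbb{B}_1)\cap C^2(\bar{\mathbb{B}}_1)$ and $\gamma\in C^2(\mathbb{B}_1)\cap C(\bar{\mathbb{B}}_1)$ satisfying $$\mathcal{L}_1 u=\gamma \ \text{ in } \mathbb{B}_1, \qquad \mathcal{L}_2\gamma\le 0 \ \text{ in } \mathbb{B}_1, \qquad u=\partial_n u=0 \ \text{ on } \partial\mathbb{B}_1.$$ If $u$ and $\gamma$ are both radially symmetric, then either $u\equiv 0$ or $u<0$ in $\mathbb{B}_1$.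
   Context: $\partial_n u$ denotes the outward normal derivative of $u$ on the boundary. *)

theory Defs
  imports "HOL-Analysis.Analysis"
begin

definition partial :: "'n::finite \<Rightarrow> (real ^ 'n \<Rightarrow> real) \<Rightarrow> real ^ 'n \<Rightarrow> real" where
  "partial j f x = deriv (\<lambda>t. f (x + t *\<^sub>R axis j 1)) 0"

definition has_partials_on :: "(real ^ 'n::finite \<Rightarrow> real) \<Rightarrow> (real ^ 'n) set \<Rightarrow> bool" where
  "has_partials_on f \<Omega> \<longleftrightarrow>
     (\<forall>j. \<forall>x\<in>\<Omega>. (\<lambda>t. f (x + t *\<^sub>R axis j 1)) differentiable (at 0))"

text \<open>
  The class \<open>C\<^sup>k(\<Omega>)\<close> for an open set \<open>\<Omega>\<close>: all partial derivatives of order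
  at most \<open>k\<close> exist and are continuous in \<open>\<Omega>\<close>.
\<close>

primrec Ck_on :: "nat \<Rightarrow> (real ^ 'n::finite \<Rightarrow> real) \<Rightarrow> (real ^ 'n) set \<Rightarrow> bool" where
  "Ck_on 0 f \<Omega> \<longleftrightarrow> continuous_on \<Omega> f"
| "Ck_on (Suc k) f \<Omega> \<longleftrightarrow>
     continuous_on \<Omega> f \<and> has_partials_on f \<Omega> \<and> (\<forall>j. Ck_on k (partial j f) \<Omega>)"

text \<open>
  The class \<open>C\<^sup>k\<close> of the closure of an open set \<open>\<Omega>\<close>: \<open>f\<close> is continuous on the
  closure, and all its partial derivatives of order at most \<open>k\<close> exist in \<open>\<Omega>\<close> and
  extend continuously to the closure. The function \<open>g\<close> below is the extension of
  \<open>partial j f\<close>; as \<open>\<Omega>\<close> is open, the partial derivatives of \<open>g\<close> in \<open>\<Omega>\<close> are those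
  of \<open>partial j f\<close>. Values of \<open>f\<close> outside the closure are irrelevant.
\<close>

primrec Ck_on_closure :: "nat \<Rightarrow> (real ^ 'n::finite \<Rightarrow> real) \<Rightarrow> (real ^ 'n) set \<Rightarrow> bool" where
  "Ck_on_closure 0 f \<Omega> \<longleftrightarrow> continuous_on (closure \<Omega>) f"
| "Ck_on_closure (Suc k) f \<Omega> \<longleftrightarrow>
     continuous_on (closure \<Omega>) f \<and> has_partials_on f \<Omega> \<and>
     (\<forall>j. \<exists>g. (\<forall>x\<in>\<Omega>. g x = partial j f x) \<and> Ck_on_closure k g \<Omega>)"

definition second_order_op ::
  "('n \<Rightarrow> 'n \<Rightarrow> real ^ 'n \<Rightarrow> real) \<Rightarrow> ('n \<Rightarrow> real ^ 'n \<Rightarrow> real) \<Rightarrow> (real ^ 'n \<Rightarrow> real)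
    \<Rightarrow> (real ^ 'n::finite \<Rightarrow> real) \<Rightarrow> real ^ 'n \<Rightarrow> real" where
  "second_order_op a b c w x =
     (\<Sum>j\<in>UNIV. \<Sum>k\<in>UNIV. a j k x * partial j (partial k w) x)
     + (\<Sum>j\<in>UNIV. b j x * partial j w x) + c x * w x"

text \<open>
  The derivative at a boundary point \<open>x\<close> in the outward normal direction \<open>n\<close>. Functions
  are only meaningful on the closed domain, so the derivative is one-sided, taken along
  \<open>x + t n\<close> with \<open>t < 0\<close>.
\<close>

definition has_outward_derivative ::
  "(real ^ 'n::finite \<Rightarrow> real) \<Rightarrow> real \<Rightarrow> real ^ 'n \<Rightarrow> real ^ 'n \<Rightarrow> bool" where
  "has_outward_derivative f D n x \<longleftrightarrow>
     ((\<lambda>t. f (x + t *\<^sub>R n)) has_real_derivative D) (at_left 0)"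

definition radially_symmetric_on :: "(real ^ 'n::finite) set \<Rightarrow> (real ^ 'n \<Rightarrow> real) \<Rightarrow> bool" where
  "radially_symmetric_on S f \<longleftrightarrow> (\<forall>x\<in>S. \<forall>y\<in>S. norm x = norm y \<longrightarrow> f x = f y)"

end

theory Submission
  imports Defs
begin

text \<open>
  On radial functions an elliptic operator acts as an ordinary differential operator
  \<open>A W'' + D W' + C W\<close> in the radius, with \<open>A \<ge> \<eta>\<close>, \<open>C \<le> 0\<close> and a coefficient \<open>D\<close> whose only
  singularity is a nonnegative multiple of \<open>1 / t\<close> at the origin. The operator is read off along
  one coordinate axis, where the Hessian of a radial function is diagonal
  (\<open>second_order_op_on_axis\<close>).

  Let \<open>U\<close> and \<open>G\<close> be the profiles of \<open>u\<close> and \<open>\<gamma>\<close>. Since \<open>G\<close> is a supersolution, the maximum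
  principle on balls prevents it from returning to nonnegative values at a larger radius: there
  is a radius \<open>r\<close> with \<open>G \<ge> 0\<close> inside and \<open>G < 0\<close> outside. If \<open>G\<close> is never negative, then
  \<open>L U \<ge> 0\<close> and \<open>U \<le> 0\<close>, and a nonzero \<open>U\<close> would have nonzero slope at the boundary by Hopf's
  lemma. Otherwise \<open>L U < 0\<close> on the outer annulus, where \<open>U\<close> has vanishing value and slope on
  the outer boundary; by Hopf's lemma again \<open>U < 0\<close> there, including at radius \<open>r\<close>
  (\<open>neg_if_L_neg_and_flat_at_1\<close>). Here \<open>r\<close> is positive, for otherwise the maximum principle would
  give \<open>U \<ge> 0\<close> on the whole ball. On the inner ball \<open>L U \<ge> 0\<close> with negative boundary values, so
  \<open>U < 0\<close> throughout (\<open>ball_max_principle\<close>).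

  The maximum principles rest on two explicit strict subsolutions: \<open>exp (\<mu> t\<^sup>2)\<close> on balls, which
  tolerates the singularity of \<open>D\<close>, and Hopf's barrier \<open>exp (- \<mu> t)\<close> on annuli.
\<close>

section \<open>Second derivatives at a maximum\<close>

text \<open>
  Carrying the derivatives as explicit functions lets combinations of a profile and a barrier
  be differentiated symbolically.
\<close>

definition two_derivs :: "(real \<Rightarrow> real) \<Rightarrow> (real \<Rightarrow> real) \<Rightarrow> (real \<Rightarrow> real) \<Rightarrow> real set \<Rightarrow> bool" where
  "two_derivs W W1 W2 S \<longleftrightarrow>
     (\<forall>t\<in>S. (W has_real_derivative W1 t) (at t) \<and> (W1 has_real_derivative W2 t) (at t))"

lemma two_derivsD:
  assumes "two_derivs W W1 W2 S" "t \<in> S"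
  shows "(W has_real_derivative W1 t) (at t)" "(W1 has_real_derivative W2 t) (at t)"
  using assms by (auto simp: two_derivs_def)

lemma two_derivs_uminus:
  assumes "two_derivs W W1 W2 S"
  shows "two_derivs (\<lambda>t. - W t) (\<lambda>t. - W1 t) (\<lambda>t. - W2 t) S"
  using assms by (auto simp: two_derivs_def intro!: DERIV_minus)

lemma two_derivs_perturbed:
  assumes "two_derivs W W1 W2 S" "two_derivs H H1 H2 S"
  shows "two_derivs (\<lambda>t. W t + e * H t - c) (\<lambda>t. W1 t + e * H1 t) (\<lambda>t. W2 t + e * H2 t) S"
  using assms unfolding two_derivs_def by (auto intro!: derivative_eq_intros)

lemma two_derivs_subset: "two_derivs W W1 W2 S \<Longrightarrow> T \<subseteq> S \<Longrightarrow> two_derivs W W1 W2 T"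
  by (auto simp: two_derivs_def)

lemma two_derivs_continuous_on:
  assumes "two_derivs W W1 W2 S" shows "continuous_on S W"
  using assms unfolding two_derivs_def
  by (meson DERIV_isCont continuous_at_imp_continuous_on)

text \<open>
  If the second derivative were positive, \<open>W1\<close> would be positive just to the right of \<open>t\<close>,
  and the mean value theorem would make \<open>W\<close> larger there.
\<close>

lemma local_max_second_deriv:
  fixes W W1 :: "real \<Rightarrow> real"
  assumes d: "d > 0"
    and W: "\<And>s. \<bar>t - s\<bar> < d \<Longrightarrow> (W has_real_derivative W1 s) (at s)"
    and W1: "(W1 has_real_derivative D2) (at t)"
    and mx: "\<And>s. \<bar>t - s\<bar> < d \<Longrightarrow> W s \<le> W t"
  shows "W1 t = 0" "D2 \<le> 0"
proof -
  show z: "W1 t = 0"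
    using DERIV_local_max[OF W d] mx d by simp
  show "D2 \<le> 0"
  proof (rule ccontr)
    assume "\<not> D2 \<le> 0"
    then obtain e where e: "e > 0" "\<And>h. 0 < h \<Longrightarrow> h < e \<Longrightarrow> W1 t < W1 (t + h)"
      using DERIV_pos_inc_right[OF W1] by auto
    define h where "h = min d e / 2"
    have h: "0 < h" "h < d" "h < e" using d e by (auto simp: h_def)
    have "\<exists>y. t < y \<and> y < t + h \<and> W (t + h) - W t = (t + h - t) * W1 y"
      by (rule MVT2) (use h in \<open>auto intro!: W\<close>)
    then obtain y where y: "t < y" "y < t + h" "W (t + h) - W t = h * W1 y" by auto
    have "W1 y > 0" using e(2)[of "y - t"] y h z by auto
    hence "W (t + h) > W t" using y h mult_pos_pos[of h "W1 y"] by linarith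
    thus False using mx[of "t + h"] h by auto
  qed
qed

lemma DERIV_eventually_zero:
  fixes W :: "real \<Rightarrow> real"
  assumes "(W has_real_derivative D) (at s)" "\<forall>\<^sub>F r in nhds s. W r = 0"
  shows "D = 0"
proof -
  have "((\<lambda>_. 0) has_real_derivative D) (at s)"
    using assms(1) DERIV_cong_ev[OF refl assms(2) refl] by blast
  thus ?thesis using DERIV_unique DERIV_const by blast
qed

section \<open>Maximum principles for radial profiles\<close>

text \<open>
  The ordinary differential operator \<open>A W'' + D W' + C W\<close> which a second-order elliptic
  operator induces on radial profiles. The tangential second derivatives of a radial function
  contribute \<open>W' / t\<close> times a nonnegative trace, which is why \<open>D\<close> is bounded below up to the
  origin, while its upper bound blows up like \<open>1 / t\<close>.
\<close>

locale radial_operator =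
  fixes A D C :: "real \<Rightarrow> real" and \<eta> M :: real
  assumes eta_pos: "\<eta> > 0"
    and A_ge: "\<And>t. 0 \<le> t \<Longrightarrow> t < 1 \<Longrightarrow> \<eta> \<le> A t"
    and D_ge: "\<And>t. 0 \<le> t \<Longrightarrow> t < 1 \<Longrightarrow> - M \<le> D t"
    and D_le: "\<And>t. 0 < t \<Longrightarrow> t < 1 \<Longrightarrow> D t \<le> M + M / t"
    and C_ge: "\<And>t. 0 \<le> t \<Longrightarrow> t < 1 \<Longrightarrow> - M \<le> C t"
    and C_le: "\<And>t. 0 \<le> t \<Longrightarrow> t < 1 \<Longrightarrow> C t \<le> 0"
begin

definition L :: "(real \<Rightarrow> real) \<Rightarrow> (real \<Rightarrow> real) \<Rightarrow> (real \<Rightarrow> real) \<Rightarrow> real \<Rightarrow> real" where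
  "L W W1 W2 t = A t * W2 t + D t * W1 t + C t * W t"

lemma M_nonneg: "M \<ge> 0"
  using C_ge[of 0] C_le[of 0] by auto

lemma L_uminus: "L (\<lambda>t. - W t) (\<lambda>t. - W1 t) (\<lambda>t. - W2 t) t = - L W W1 W2 t"
  by (simp add: L_def)

lemma L_nonpos_at_max:
  assumes "0 \<le> t" "t < 1" "d > 0"
    and "two_derivs W W1 W2 {t - d<..<t + d}"
    and "\<And>s. \<bar>t - s\<bar> < d \<Longrightarrow> W s \<le> W t" and "0 \<le> W t"
  shows "L W W1 W2 t \<le> 0"
proof -
  have der: "(W has_real_derivative W1 s) (at s)" "(W1 has_real_derivative W2 s) (at s)"
    if "\<bar>t - s\<bar> < d" for s
    by (rule two_derivsD[OF assms(4)], use that in auto)+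
  have "W1 t = 0" "W2 t \<le> 0"
    using local_max_second_deriv[of d t W W1 "W2 t"] der assms by auto
  thus ?thesis using A_ge[of t] C_le[of t] assms eta_pos
    by (simp add: L_def mult_nonneg_nonpos mult_nonpos_nonneg add_nonpos_nonpos)
qed

text \<open>
  Adding a small multiple of a strict barrier makes a subsolution strict. Subtracting a
  constant \<open>c \<ge> 0\<close> is harmless because \<open>C \<le> 0\<close>; the constant shifts boundary values to zero.
\<close>

lemma L_perturbed_pos:
  assumes "L W W1 W2 t \<ge> 0" "L H H1 H2 t > 0" "e > 0" "c \<ge> 0" "0 \<le> t" "t < 1"
  shows "L (\<lambda>t. W t + e * H t - c) (\<lambda>t. W1 t + e * H1 t) (\<lambda>t. W2 t + e * H2 t) t > 0"
proof -
  have "L (\<lambda>t. W t + e * H t - c) (\<lambda>t. W1 t + e * H1 t) (\<lambda>t. W2 t + e * H2 t) t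
      = L W W1 W2 t + e * L H H1 H2 t - C t * c"
    by (simp add: L_def algebra_simps)
  moreover have "C t * c \<le> 0" using C_le assms by (simp add: mult_nonpos_nonneg)
  moreover have "e * L H H1 H2 t > 0" using assms by simp
  ultimately show ?thesis using assms by linarith
qed

text \<open>
  The profile of \<open>exp (\<mu> |x|\<^sup>2)\<close> is even and smooth at the origin, and its first derivative is
  nonnegative, so that only the lower bound of \<open>D\<close> matters and the singularity of \<open>D\<close> does no
  harm. With \<open>s = 2 \<mu> t\<close> the requirement is that \<open>\<eta> (2 \<mu> + s\<^sup>2) - M s - M\<close> be positive for
  all \<open>s\<close>, which holds once \<open>\<mu>\<close> makes the discriminant negative.
\<close>

lemma ball_barrier:
  obtains \<mu> where
    "two_derivs (\<lambda>t. exp (\<mu> * t\<^sup>2)) (\<lambda>t. 2 * \<mu> * t * exp (\<mu> * t\<^sup>2))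
       (\<lambda>t. (2 * \<mu> + (2 * \<mu> * t)\<^sup>2) * exp (\<mu> * t\<^sup>2)) UNIV"
    "\<And>t. 0 \<le> t \<Longrightarrow> t < 1 \<Longrightarrow> L (\<lambda>t. exp (\<mu> * t\<^sup>2)) (\<lambda>t. 2 * \<mu> * t * exp (\<mu> * t\<^sup>2))
       (\<lambda>t. (2 * \<mu> + (2 * \<mu> * t)\<^sup>2) * exp (\<mu> * t\<^sup>2)) t > 0"
proof -
  \<comment> \<open>The term \<open>M\<^sup>2 / (4 \<eta>)\<close> completes the square \<open>\<eta> s\<^sup>2 - M s\<close> below.\<close>
  define \<mu> where "\<mu> = (M + M\<^sup>2 / (4 * \<eta>) + 1) / (2 * \<eta>)"
  have lam: "\<mu> > 0" using M_nonneg eta_pos by (simp add: \<mu>_def add_nonneg_pos)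
  have lam_eq: "2 * \<mu> * \<eta> = M + M\<^sup>2 / (4 * \<eta>) + 1" using eta_pos by (simp add: \<mu>_def)
  have "two_derivs (\<lambda>t. exp (\<mu> * t\<^sup>2)) (\<lambda>t. 2 * \<mu> * t * exp (\<mu> * t\<^sup>2))
       (\<lambda>t. (2 * \<mu> + (2 * \<mu> * t)\<^sup>2) * exp (\<mu> * t\<^sup>2)) UNIV"
    unfolding two_derivs_def
    by (auto intro!: derivative_eq_intros simp: algebra_simps power2_eq_square)
  moreover have "L (\<lambda>t. exp (\<mu> * t\<^sup>2)) (\<lambda>t. 2 * \<mu> * t * exp (\<mu> * t\<^sup>2))
       (\<lambda>t. (2 * \<mu> + (2 * \<mu> * t)\<^sup>2) * exp (\<mu> * t\<^sup>2)) t > 0" if t: "0 \<le> t" "t < 1" for t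
  proof -
    define s where "s = 2 * \<mu> * t"
    have s: "s \<ge> 0" using t lam by (simp add: s_def)
    have "A t * (2 * \<mu> + s\<^sup>2) \<ge> \<eta> * (2 * \<mu> + s\<^sup>2)"
      using A_ge[OF t] lam by (intro mult_right_mono) auto
    moreover have "D t * s \<ge> - M * s" using D_ge[OF t] s by (intro mult_right_mono) auto
    moreover have "C t \<ge> - M" using C_ge[OF t] .
    moreover have "\<eta> * s\<^sup>2 - M * s + M\<^sup>2 / (4 * \<eta>) = \<eta> * (s - M / (2 * \<eta>))\<^sup>2"
      using eta_pos by (simp add: power2_eq_square field_simps)
    moreover have "\<eta> * (s - M / (2 * \<eta>))\<^sup>2 \<ge> 0" using eta_pos by simp
    ultimately have "A t * (2 * \<mu> + s\<^sup>2) + D t * s + C t > 0"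
      using lam_eq by (simp add: algebra_simps)
    hence "(A t * (2 * \<mu> + s\<^sup>2) + D t * s + C t) * exp (\<mu> * t\<^sup>2) > 0" by simp
    thus ?thesis by (simp add: L_def s_def algebra_simps)
  qed
  ultimately show thesis using that by blast
qed

text \<open>
  The barrier of Hopf's lemma: it decreases strictly up to the outer boundary. Its first
  derivative is negative, so the upper bound of \<open>D\<close> is needed, and this forces a positive
  inner radius.
\<close>

lemma annulus_barrier:
  assumes "0 < \<rho>"
  obtains \<mu> where "\<mu> > 0"
    "two_derivs (\<lambda>t. exp (- \<mu> * t)) (\<lambda>t. - \<mu> * exp (- \<mu> * t)) (\<lambda>t. \<mu>\<^sup>2 * exp (- \<mu> * t)) UNIV"
    "\<And>t. \<rho> < t \<Longrightarrow> t < 1 \<Longrightarrow>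
       L (\<lambda>t. exp (- \<mu> * t)) (\<lambda>t. - \<mu> * exp (- \<mu> * t)) (\<lambda>t. \<mu>\<^sup>2 * exp (- \<mu> * t)) t > 0"
proof -
  define K where "K = M + M / \<rho>"
  \<comment> \<open>Large enough that \<open>\<eta> \<mu>\<^sup>2 > K \<mu> + M\<close>, where \<open>K\<close> bounds \<open>D\<close> from above on the annulus.\<close>
  define \<mu> where "\<mu> = (K + M + 1) / \<eta> + 1"
  have K: "K \<ge> 0" using M_nonneg assms by (simp add: K_def)
  have lam: "\<mu> \<ge> 1" using K M_nonneg eta_pos by (simp add: \<mu>_def)
  have lam_eq: "\<mu> * \<eta> = K + M + 1 + \<eta>" using eta_pos by (simp add: \<mu>_def field_simps)
  have "two_derivs (\<lambda>t. exp (- \<mu> * t)) (\<lambda>t. - \<mu> * exp (- \<mu> * t)) (\<lambda>t. \<mu>\<^sup>2 * exp (- \<mu> * t)) UNIV"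
    unfolding two_derivs_def
    by (auto intro!: derivative_eq_intros simp: algebra_simps power2_eq_square)
  moreover have "L (\<lambda>t. exp (- \<mu> * t)) (\<lambda>t. - \<mu> * exp (- \<mu> * t)) (\<lambda>t. \<mu>\<^sup>2 * exp (- \<mu> * t)) t > 0"
    if t: "\<rho> < t" "t < 1" for t
  proof -
    have t0: "0 < t" using t assms by simp
    have "M / t \<le> M / \<rho>" using t assms M_nonneg by (intro divide_left_mono) auto
    hence "D t \<le> K" using D_le[of t] t t0 by (simp add: K_def)
    hence "\<mu> * D t \<le> \<mu> * K" using lam by simp
    moreover have "\<eta> * \<mu>\<^sup>2 \<le> A t * \<mu>\<^sup>2" using A_ge[of t] t t0 by (intro mult_right_mono) auto
    moreover have "C t \<ge> - M" using C_ge[of t] t t0 by simp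
    moreover obtain X where "X = \<mu> * (M + 1 + \<eta>)" "\<eta> * \<mu>\<^sup>2 = \<mu> * K + X"
    proof
      have "\<eta> * \<mu>\<^sup>2 = \<mu> * (\<mu> * \<eta>)" by (simp add: power2_eq_square)
      thus "\<eta> * \<mu>\<^sup>2 = \<mu> * K + \<mu> * (M + 1 + \<eta>)" unfolding lam_eq by (simp add: distrib_left)
    qed simp
    moreover have "1 * (M + 1 + \<eta>) \<le> \<mu> * (M + 1 + \<eta>)"
      using lam M_nonneg eta_pos by (intro mult_right_mono) auto
    hence "M + 1 + \<eta> \<le> X" using \<open>X = _\<close> by simp
    ultimately have "A t * \<mu>\<^sup>2 - \<mu> * D t + C t > 0" using eta_pos by linarith
    hence "(A t * \<mu>\<^sup>2 - \<mu> * D t + C t) * exp (- \<mu> * t) > 0" by simp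
    thus ?thesis by (simp add: L_def algebra_simps)
  qed
  moreover have "\<mu> > 0" using lam by simp
  ultimately show thesis using that by blast
qed

text \<open>
  Evenness makes a maximum over \<open>{0..R}\<close> that is attained at the origin a two-sided local
  maximum, so the second derivative test applies there as well.
\<close>

lemma ball_comparison:
  assumes R: "0 < R" "R \<le> 1"
    and V: "two_derivs V V1 V2 {-1<..<1}" and cont: "continuous_on {0..R} V"
    and even: "\<And>t. \<bar>t\<bar> < 1 \<Longrightarrow> V (- t) = V t"
    and pos: "\<And>t. 0 \<le> t \<Longrightarrow> t < R \<Longrightarrow> L V V1 V2 t > 0"
    and bd: "V R \<le> 0" and t: "0 \<le> t" "t \<le> R"
  shows "V t \<le> 0"
proof (rule ccontr)
  assume "\<not> V t \<le> 0"
  obtain m where m: "m \<in> {0..R}" "\<And>s. s \<in> {0..R} \<Longrightarrow> V s \<le> V m"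
    using continuous_attains_sup[OF compact_Icc _ cont] R by auto
  have "V m > 0" using m(2)[of t] t \<open>\<not> V t \<le> 0\<close> by auto
  hence mR: "0 \<le> m" "m < R" using m(1) bd by (auto simp: less_le)
  have le: "V s \<le> V m" if "\<bar>m - s\<bar> < R - m" for s
  proof -
    have "V s = V \<bar>s\<bar>" using even[of s] that mR R by (cases "s \<ge> 0") auto
    thus ?thesis using m(2)[of "\<bar>s\<bar>"] that mR by auto
  qed
  have "L V V1 V2 m \<le> 0"
    by (rule L_nonpos_at_max[where d = "R - m"])
       (use mR R le \<open>V m > 0\<close> in \<open>auto intro!: two_derivs_subset[OF V]\<close>)
  thus False using pos[OF mR] by simp
qed

lemma annulus_comparison:
  assumes R: "0 < \<rho>" "\<rho> < 1"
    and V: "two_derivs V V1 V2 {-1<..<1}" and cont: "continuous_on {\<rho>..1} V"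
    and pos: "\<And>t. \<rho> < t \<Longrightarrow> t < 1 \<Longrightarrow> L V V1 V2 t > 0"
    and bd: "V \<rho> \<le> 0" "V 1 \<le> 0" and t: "\<rho> \<le> t" "t \<le> 1"
  shows "V t \<le> 0"
proof (rule ccontr)
  assume "\<not> V t \<le> 0"
  obtain m where m: "m \<in> {\<rho>..1}" "\<And>s. \<rho> \<le> s \<Longrightarrow> s \<le> 1 \<Longrightarrow> V s \<le> V m"
    using continuous_attains_sup[OF compact_Icc _ cont] R by auto
  have "V m > 0" using m(2)[of t] t \<open>\<not> V t \<le> 0\<close> by auto
  hence mR: "\<rho> < m" "m < 1" using m(1) bd by (auto simp: less_le)
  have "L V V1 V2 m \<le> 0"
    by (rule L_nonpos_at_max[where d = "min (m - \<rho>) (1 - m)"])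
       (use mR R m(1) \<open>V m > 0\<close> in \<open>auto intro!: two_derivs_subset[OF V] m(2)\<close>)
  thus False using pos[OF mR] by simp
qed

text \<open>
  Comparison with the barrier \<open>h\<close> gives \<open>W \<le> e (h(R) - h)\<close> for every \<open>e > 0\<close> in the weak
  case, and \<open>W \<le> - e h\<close> for one fixed \<open>e > 0\<close> in the strict case.
\<close>

lemma ball_max_principle:
  assumes R: "0 < R" "R \<le> 1"
    and W: "two_derivs W W1 W2 {-1<..<1}" and cont: "continuous_on {0..R} W"
    and even: "\<And>t. \<bar>t\<bar> < 1 \<Longrightarrow> W (- t) = W t"
    and nonneg: "\<And>t. 0 \<le> t \<Longrightarrow> t < R \<Longrightarrow> L W W1 W2 t \<ge> 0"
    and t: "0 \<le> t" "t \<le> R"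
  shows "W R \<le> 0 \<Longrightarrow> W t \<le> 0" "W R < 0 \<Longrightarrow> W t < 0"
proof -
  obtain \<mu> where H: "two_derivs (\<lambda>t. exp (\<mu> * t\<^sup>2)) (\<lambda>t. 2 * \<mu> * t * exp (\<mu> * t\<^sup>2))
       (\<lambda>t. (2 * \<mu> + (2 * \<mu> * t)\<^sup>2) * exp (\<mu> * t\<^sup>2)) UNIV"
    "\<And>t. 0 \<le> t \<Longrightarrow> t < 1 \<Longrightarrow> L (\<lambda>t. exp (\<mu> * t\<^sup>2)) (\<lambda>t. 2 * \<mu> * t * exp (\<mu> * t\<^sup>2))
       (\<lambda>t. (2 * \<mu> + (2 * \<mu> * t)\<^sup>2) * exp (\<mu> * t\<^sup>2)) t > 0"
    using ball_barrier by blast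
  have key: "W t + e * exp (\<mu> * t\<^sup>2) - c \<le> 0"
    if ec: "e > 0" "c \<ge> 0" "W R + e * exp (\<mu> * R\<^sup>2) - c \<le> 0" for e c
    by (rule ball_comparison[OF R two_derivs_perturbed[OF W two_derivs_subset[OF H(1)]]])
       (use R t ec cont in \<open>auto intro!: L_perturbed_pos nonneg H(2) continuous_intros simp: even\<close>)
  { assume le: "W R \<le> 0"
    show "W t \<le> 0"
    proof (rule field_le_epsilon)
      fix e :: real assume e: "e > 0"
      define e' where "e' = e / exp (\<mu> * R\<^sup>2)"
      have "e' > 0" "e' * exp (\<mu> * R\<^sup>2) = e" using e by (auto simp: e'_def)
      hence "W t + e' * exp (\<mu> * t\<^sup>2) - e \<le> 0" "e' * exp (\<mu> * t\<^sup>2) > 0"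
        using key[of e' e] le e by auto
      thus "W t \<le> 0 + e" by linarith
    qed }
  { assume less: "W R < 0"
    define e where "e = - W R / exp (\<mu> * R\<^sup>2)"
    have "e > 0" "e * exp (\<mu> * R\<^sup>2) = - W R" using less by (auto simp: e_def divide_neg_pos)
    hence "W t + e * exp (\<mu> * t\<^sup>2) \<le> 0" "e * exp (\<mu> * t\<^sup>2) > 0"
      using key[of e 0] by auto
    thus "W t < 0" by linarith }
qed

text \<open>
  Both parts compare \<open>W\<close> with the barrier \<open>h = exp (- \<mu> t)\<close>. For the weak maximum principle
  \<open>W + e h \<le> e h(\<rho>)\<close>, and \<open>e\<close> tends to zero. For Hopf's lemma the strict
  inequality at \<open>\<rho>\<close> leaves room for a fixed \<open>e\<close> with \<open>W \<le> e (h(1) - h)\<close>; both sides vanish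
  at \<open>1\<close> and the right-hand side has positive slope there.
\<close>

lemma annulus_max_principle:
  assumes R: "0 < \<rho>" "\<rho> < 1"
    and W: "two_derivs W W1 W2 {-1<..<1}" and cont: "continuous_on {\<rho>..1} W"
    and nonneg: "\<And>t. \<rho> < t \<Longrightarrow> t < 1 \<Longrightarrow> L W W1 W2 t \<ge> 0"
    and bd: "W 1 \<le> 0"
  shows "W \<rho> \<le> 0 \<Longrightarrow> \<rho> \<le> t \<Longrightarrow> t \<le> 1 \<Longrightarrow> W t \<le> 0"
    and "W \<rho> < 0 \<Longrightarrow> W 1 = 0 \<Longrightarrow> \<not> (W has_real_derivative 0) (at_left 1)"
proof -
  obtain \<mu> where lam: "\<mu> > 0" and H:
    "two_derivs (\<lambda>t. exp (- \<mu> * t)) (\<lambda>t. - \<mu> * exp (- \<mu> * t)) (\<lambda>t. \<mu>\<^sup>2 * exp (- \<mu> * t)) UNIV"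
    "\<And>t. \<rho> < t \<Longrightarrow> t < 1 \<Longrightarrow>
       L (\<lambda>t. exp (- \<mu> * t)) (\<lambda>t. - \<mu> * exp (- \<mu> * t)) (\<lambda>t. \<mu>\<^sup>2 * exp (- \<mu> * t)) t > 0"
    using annulus_barrier[OF R(1)] by blast
  have key: "W t + e * exp (- \<mu> * t) - c \<le> 0"
    if ec: "e > 0" "c \<ge> 0" "W \<rho> + e * exp (- \<mu> * \<rho>) - c \<le> 0" "W 1 + e * exp (- \<mu> * 1) - c \<le> 0"
      and t: "\<rho> \<le> t" "t \<le> 1" for e c t
  proof (rule annulus_comparison[OF R two_derivs_perturbed[OF W two_derivs_subset[OF H(1)]] _ _ ec(3,4) t])
    fix s assume s: "\<rho> < s" "s < 1"
    show "0 < L (\<lambda>t. W t + e * exp (- \<mu> * t) - c) (\<lambda>t. W1 t + e * (- \<mu> * exp (- \<mu> * t)))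
        (\<lambda>t. W2 t + e * (\<mu>\<^sup>2 * exp (- \<mu> * t))) s"
      by (rule L_perturbed_pos[OF nonneg[OF s] H(2)[OF s] ec(1,2)]) (use R s in auto)
  qed (use cont in \<open>auto intro!: continuous_intros\<close>)
  { assume le: "W \<rho> \<le> 0" and t: "\<rho> \<le> t" "t \<le> 1"
    show "W t \<le> 0"
    proof (rule field_le_epsilon)
      fix e :: real assume e: "e > 0"
      define e' where "e' = e / exp (- \<mu> * \<rho>)"
      have e': "e' > 0" "e' * exp (- \<mu> * \<rho>) = e" using e by (auto simp: e'_def)
      have "exp (- \<mu> * 1) \<le> exp (- \<mu> * \<rho>)" using R lam by simp
      hence "e' * exp (- \<mu> * 1) \<le> e" using e' by (metis mult_le_cancel_left_pos)
      hence "W t + e' * exp (- \<mu> * t) - e \<le> 0" "e' * exp (- \<mu> * t) > 0"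
        using key[of e' e t] le e e' bd t by auto
      thus "W t \<le> 0 + e" by linarith
    qed }
  { assume less: "W \<rho> < 0" and W1: "W 1 = 0"
    define e where "e = - W \<rho> / exp (- \<mu> * \<rho>)"
    have e: "e > 0" "e * exp (- \<mu> * \<rho>) = - W \<rho>" using less by (auto simp: e_def divide_neg_pos)
    define F where "F t = W t + e * exp (- \<mu> * t) - e * exp (- \<mu> * 1)" for t
    have F: "F t \<le> 0" if "\<rho> \<le> t" "t \<le> 1" for t
      unfolding F_def by (rule key) (use e W1 that in auto)
    have F1: "F 1 = 0" by (simp add: F_def W1)
    show "\<not> (W has_real_derivative 0) (at_left 1)"
    proof
      assume "(W has_real_derivative 0) (at_left 1)"
      hence "(F has_real_derivative (- e * \<mu> * exp (- \<mu> * 1))) (at_left 1)"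
        unfolding F_def by (auto intro!: derivative_eq_intros)
      moreover have "- e * \<mu> * exp (- \<mu> * 1) < 0" using e lam by (simp add: mult_neg_pos)
      ultimately obtain d where d: "d > 0" "\<And>h. 0 < h \<Longrightarrow> 1 - h \<in> {..<1} \<Longrightarrow> h < d \<Longrightarrow> F 1 < F (1 - h)"
        using has_real_derivative_neg_dec_left[of F _ 1 "{..<1}"] by blast
      define h where "h = min d (1 - \<rho>) / 2"
      have "0 < h" "h < d" "h < 1 - \<rho>" using d(1) R by (auto simp: h_def)
      thus False using d(2)[of h] F[of "1 - h"] F1 by auto
    qed }
qed

text \<open>
  If \<open>W \<rho> \<ge> 0\<close>, the weak maximum principle applied to \<open>- W\<close> gives \<open>W \<ge> 0\<close> on the annulus.
  A positive value inside would contradict Hopf's lemma at the flat boundary point \<open>1\<close>, so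
  \<open>W\<close> vanishes identically, and then \<open>L W\<close> is zero rather than negative.
\<close>

lemma neg_if_L_neg_and_flat_at_1:
  assumes R: "0 < \<rho>" "\<rho> < 1"
    and W: "two_derivs W W1 W2 {-1<..<1}" and cont: "continuous_on {\<rho>..1} W"
    and neg: "\<And>t. \<rho> < t \<Longrightarrow> t < 1 \<Longrightarrow> L W W1 W2 t < 0"
    and bd: "W 1 = 0" "(W has_real_derivative 0) (at_left 1)"
  shows "W \<rho> < 0"
proof (rule ccontr)
  assume nn: "\<not> W \<rho> < 0"
  note W' = two_derivs_uminus[OF W]
  have cont': "continuous_on {t..1} (\<lambda>t. - W t)" if "\<rho> \<le> t" for t
    by (intro continuous_intros continuous_on_subset[OF cont]) (use that in auto)
  have bd': "((\<lambda>t. - W t) has_real_derivative 0) (at_left 1)"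
    using DERIV_minus[OF bd(2)] by simp
  have ge: "W t \<ge> 0" if "\<rho> \<le> t" "t \<le> 1" for t
  proof -
    have "- W t \<le> 0"
      by (rule annulus_max_principle(1)[OF R W' cont'[OF order_refl] _ _ _ that])
         (use neg nn in \<open>simp_all add: L_uminus bd less_imp_le\<close>)
    thus ?thesis by simp
  qed
  have zero: "W t = 0" if t: "\<rho> < t" "t < 1" for t
  proof (rule ccontr)
    assume "W t \<noteq> 0"
    hence "- W t < 0" using ge[of t] t by auto
    hence "\<not> ((\<lambda>t. - W t) has_real_derivative 0) (at_left 1)"
      by (intro annulus_max_principle(2)[OF _ t(2) W' cont'])
         (use neg t R in \<open>simp_all add: L_uminus bd less_imp_le\<close>)
    thus False using bd' by simp
  qed
  have nhds: "\<forall>\<^sub>F r in nhds s. \<rho> < r \<and> r < 1" if "\<rho> < s" "s < 1" for s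
    using eventually_nhds_in_open[of "{\<rho><..<1}" s] that by simp
  have W1_zero: "W1 s = 0" if s: "\<rho> < s" "s < 1" for s
  proof (rule DERIV_eventually_zero)
    show "(W has_real_derivative W1 s) (at s)" by (rule two_derivsD[OF W]) (use s R in simp)
    show "\<forall>\<^sub>F r in nhds s. W r = 0" by (rule eventually_mono[OF nhds[OF s]]) (simp add: zero)
  qed
  define t where "t = (\<rho> + 1) / 2"
  have t: "\<rho> < t" "t < 1" using R by (auto simp: t_def)
  have "W2 t = 0"
  proof (rule DERIV_eventually_zero)
    show "(W1 has_real_derivative W2 t) (at t)" by (rule two_derivsD[OF W]) (use t R in simp)
    show "\<forall>\<^sub>F r in nhds t. W1 r = 0" by (rule eventually_mono[OF nhds[OF t]]) (simp add: W1_zero)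
  qed
  thus False using neg[OF t] zero[OF t] W1_zero[OF t] by (simp add: L_def)
qed

end

section \<open>The dichotomy for radial profiles\<close>

text \<open>
  The maximum principle for \<open>G\<close> shows that once \<open>G\<close> is negative it stays negative for larger
  radii, so \<open>G \<ge> 0\<close> before some radius \<open>r\<close> and \<open>G < 0\<close> after it. If \<open>G\<close> is never negative,
  \<open>U\<close> is a nonpositive subsolution, and Hopf's lemma together with \<open>U'(1) = 0\<close> forces
  \<open>U = 0\<close>. Otherwise the overdetermined boundary condition gives \<open>U < 0\<close> on the positive
  radii in \<open>{r..<1}\<close>, and the maximum principle on the ball of radius \<open>r\<close>, where \<open>U\<close> is a
  subsolution with negative boundary value, propagates the sign to the centre.
\<close>

lemma radial_dichotomy:
  assumes "radial_operator A D C \<eta> M" and "radial_operator A' D' C' \<eta> M'"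
    and U: "two_derivs U U1 U2 {-1<..<1}" and contU: "continuous_on {0..1} U"
    and evenU: "\<And>t. \<bar>t\<bar> < 1 \<Longrightarrow> U (- t) = U t"
    and G: "two_derivs G G1 G2 {-1<..<1}"
    and evenG: "\<And>t. \<bar>t\<bar> < 1 \<Longrightarrow> G (- t) = G t"
    and eq: "\<And>t. 0 \<le> t \<Longrightarrow> t < 1 \<Longrightarrow> A t * U2 t + D t * U1 t + C t * U t = G t"
    and ineq: "\<And>t. 0 \<le> t \<Longrightarrow> t < 1 \<Longrightarrow> A' t * G2 t + D' t * G1 t + C' t * G t \<le> 0"
    and bd: "U 1 = 0" "(U has_real_derivative 0) (at_left 1)"
  shows "(\<forall>t\<in>{0..<1}. U t = 0) \<or> (\<forall>t\<in>{0..<1}. U t < 0)"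
proof -
  interpret L1: radial_operator A D C \<eta> M by fact
  interpret L2: radial_operator A' D' C' \<eta> M' by fact
  have LU: "L1.L U U1 U2 t = G t" if "0 \<le> t" "t < 1" for t using eq[OF that] by (simp add: L1.L_def)
  have LG: "L2.L G G1 G2 t \<le> 0" if "0 \<le> t" "t < 1" for t using ineq[OF that] by (simp add: L2.L_def)
  have contG: "continuous_on {-1<..<1} G" using two_derivs_continuous_on[OF G] .
  have contU': "continuous_on {0..1} (\<lambda>t. - U t)" using contU by (intro continuous_intros)
  have up: "G t < 0" if st: "0 \<le> s" "s < t" "t < 1" "G s < 0" for s t
  proof (rule ccontr)
    assume "\<not> G t < 0"
    have "- G s \<le> 0"
      by (rule L2.ball_max_principle(1)[OF _ _ two_derivs_uminus[OF G], of t])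
         (use st LG \<open>\<not> G t < 0\<close> in \<open>auto intro!: continuous_intros continuous_on_subset[OF contG]
            simp: evenG L2.L_uminus\<close>)
    thus False using st by simp
  qed
  have nn0: "U t = 0" if nn: "\<And>t. 0 \<le> t \<Longrightarrow> t < 1 \<Longrightarrow> G t \<ge> 0" and t: "0 \<le> t" "t < 1" for t
  proof -
    have U_le: "U t \<le> 0" if "0 \<le> t" "t \<le> 1" for t
      by (rule L1.ball_max_principle(1)[OF _ _ U, of 1])
         (use that contU evenU nn in \<open>auto simp: LU bd\<close>)
    have U0: "U t = 0" if t: "0 < t" "t < 1" for t
    proof (rule ccontr)
      assume "U t \<noteq> 0"
      hence "U t < 0" using U_le[of t] t by auto
      hence "\<not> (U has_real_derivative 0) (at_left 1)"
        by (intro L1.annulus_max_principle(2)[OF t U continuous_on_subset[OF contU]])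
           (use nn t in \<open>simp_all add: LU bd\<close>)
      thus False using bd by simp
    qed
    show ?thesis
    proof (rule ccontr)
      assume "U t \<noteq> 0"
      hence "t = 0" "U 0 < 0" using U0[of t] U_le[of t] t by (force simp: less_le)+
      moreover have "isCont U 0" using two_derivsD(1)[OF U, of 0] DERIV_isCont by auto
      ultimately have "\<forall>\<^sub>F s in at 0. U s < 0"
        by (auto simp: isCont_def intro: order_tendstoD)
      hence "\<forall>\<^sub>F s in at_right 0. U s < 0" by (simp add: eventually_at_split)
      moreover have "\<forall>\<^sub>F s in at_right (0::real). s \<in> {0<..<1}"
        by (rule eventually_at_right_real) simp
      ultimately have "\<forall>\<^sub>F s in at_right (0::real). False"
        by eventually_elim (use U0 in auto)
      thus False by simp
    qed
  qed
  show ?thesis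
  proof (cases "\<forall>t. 0 \<le> t \<longrightarrow> t < 1 \<longrightarrow> G t \<ge> 0")
    case True
    thus ?thesis using nn0 by auto
  next
    case False
    define N where "N = {t. 0 \<le> t \<and> t < 1 \<and> G t < 0}"
    define r where "r = Inf N"
    have N: "N \<noteq> {}" "bdd_below N" using False by (auto simp: N_def intro!: bdd_belowI[of _ 0])
    have r: "0 \<le> r" "r < 1"
    proof -
      show "0 \<le> r" unfolding r_def by (rule cInf_greatest[OF N(1)]) (simp add: N_def)
      obtain s where s: "s \<in> N" using N(1) by auto
      thus "r < 1" using cInf_lower[OF s N(2)] by (simp add: r_def N_def)
    qed
    have Gneg: "G t < 0" if t: "r < t" "t < 1" for t
    proof -
      obtain s where "s \<in> N" "s < t" using t cInf_lessD[OF N(1)] by (auto simp: r_def)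
      thus ?thesis using up[of s t] t by (auto simp: N_def)
    qed
    have Gpos: "G t \<ge> 0" if t: "0 \<le> t" "t < r" for t
    proof (rule ccontr)
      assume "\<not> G t \<ge> 0"
      hence "t \<in> N" using t r by (simp add: N_def)
      thus False using cInf_lower[OF _ N(2), of t] t by (simp add: r_def)
    qed
    have Uneg: "U t < 0" if t: "0 < t" "r \<le> t" "t < 1" for t
      by (rule L1.neg_if_L_neg_and_flat_at_1[OF t(1,3) U continuous_on_subset[OF contU] _ bd])
         (use t Gneg in \<open>auto simp: LU\<close>)
    \<comment> \<open>Otherwise \<open>U\<close> is a supersolution on the whole ball with zero boundary values, hence
      nonnegative, whereas it is negative off the origin.\<close>
    have rpos: "r > 0"
    proof (rule ccontr)
      assume "\<not> r > 0"
      hence r0: "r = 0" using r by simp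
      have "G 0 \<le> 0"
      proof (rule tendsto_upperbound)
        have "isCont G 0" using two_derivsD(1)[OF G, of 0] DERIV_isCont by auto
        thus "(G \<longlongrightarrow> G 0) (at_right 0)" by (auto simp: isCont_def intro: filterlim_at_split[THEN iffD1, THEN conjunct2])
        have "\<forall>\<^sub>F s in at_right (0::real). s \<in> {0<..<1}"
          by (rule eventually_at_right_real) simp
        thus "\<forall>\<^sub>F s in at_right 0. G s \<le> 0"
          by eventually_elim (use Gneg r0 in \<open>auto simp: less_imp_le\<close>)
      qed simp
      hence Gle: "G t \<le> 0" if "0 \<le> t" "t < 1" for t
        using Gneg[of t] r0 that by (cases "t = 0") auto
      have "- U (1/2) \<le> 0"
        by (rule L1.ball_max_principle(1)[OF _ _ two_derivs_uminus[OF U] contU', of "1/2"])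
           (use evenU Gle in \<open>auto simp: LU L1.L_uminus bd\<close>)
      thus False using Uneg[of "1/2"] r0 by auto
    qed
    have "U t < 0" if "0 \<le> t" "t \<le> r" for t
      by (rule L1.ball_max_principle(2)[OF rpos _ U _ _ _ that Uneg])
         (use rpos r evenU Gpos in \<open>auto simp: LU intro: continuous_on_subset[OF contU]\<close>)
    hence "U t < 0" if "0 \<le> t" "t < 1" for t
      using Uneg[of t] rpos that by (cases "t \<le> r") auto
    thus ?thesis by auto
  qed
qed

section \<open>Partial derivatives of radial functions on a coordinate axis\<close>

lemma norm_add_axis_sq:
  "(norm (x + t *\<^sub>R axis j 1))\<^sup>2 = (norm x)\<^sup>2 + 2 * t * x $ j + t\<^sup>2"
  for x :: "real ^ 'n::finite"
  unfolding power2_norm_eq_inner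
  by (simp add: inner_add_left inner_add_right inner_axis inner_axis' power2_eq_square algebra_simps)

lemma eventually_nhds_line_in_open:
  fixes x v :: "'a::real_normed_vector"
  assumes "open S" "x + s *\<^sub>R v \<in> S"
  shows "\<forall>\<^sub>F t in nhds s. x + t *\<^sub>R v \<in> S"
proof -
  have "open ((\<lambda>t. x + t *\<^sub>R v) -` S)" by (intro open_vimage continuous_intros assms)
  from eventually_nhds_in_open[OF this, of s] assms show ?thesis by simp
qed

lemma eventually_line_in_open:
  fixes x v :: "'a::real_normed_vector"
  assumes "open S" "x \<in> S"
  shows "\<forall>\<^sub>F t in nhds 0. x + t *\<^sub>R v \<in> S"
  using eventually_nhds_line_in_open[of S x 0 v] assms by simp

lemma has_partials_on_DERIV_line:
  assumes "has_partials_on f S" "x + s *\<^sub>R axis j 1 \<in> S"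
  shows "((\<lambda>t. f (x + t *\<^sub>R axis j 1)) has_real_derivative partial j f (x + s *\<^sub>R axis j 1)) (at s)"
proof -
  have "(\<lambda>t. f (x + s *\<^sub>R axis j 1 + t *\<^sub>R axis j 1)) differentiable (at 0)"
    using assms by (auto simp: has_partials_on_def)
  hence "((\<lambda>t. f (x + s *\<^sub>R axis j 1 + t *\<^sub>R axis j 1)) has_real_derivative
      partial j f (x + s *\<^sub>R axis j 1)) (at 0)"
    unfolding partial_def by (simp add: DERIV_deriv_iff_real_differentiable)
  hence "((\<lambda>t. f (x + (t + s) *\<^sub>R axis j 1)) has_real_derivative
      partial j f (x + s *\<^sub>R axis j 1)) (at 0)"
    by (simp add: algebra_simps)
  thus ?thesis using DERIV_shift[of "\<lambda>t. f (x + t *\<^sub>R axis j 1)" _ 0 s] by simp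
qed

lemma has_partials_on_DERIV_axis:
  assumes "has_partials_on f S" "s *\<^sub>R axis j 1 \<in> S"
  shows "((\<lambda>t. f (t *\<^sub>R axis j 1)) has_real_derivative partial j f (s *\<^sub>R axis j 1)) (at s)"
  using has_partials_on_DERIV_line[of f S 0 s j] assms by simp

lemma partial_cong:
  assumes "\<forall>\<^sub>F t in nhds 0. f (x + t *\<^sub>R axis i 1) = g (y + t *\<^sub>R axis j 1)"
  shows "partial i f x = partial j g y"
  unfolding partial_def using assms by (intro deriv_cong_ev) auto

lemma partial_zero_if_even:
  assumes "has_partials_on f S" "x \<in> S"
    and "\<forall>\<^sub>F t in nhds 0. f (x + (- t) *\<^sub>R axis j 1) = f (x + t *\<^sub>R axis j 1)"
  shows "partial j f x = 0"
proof -
  let ?g = "\<lambda>t. f (x + t *\<^sub>R axis j 1)"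
  have d: "(?g has_real_derivative partial j f x) (at 0)"
    using has_partials_on_DERIV_line[of f S x 0 j] assms by simp
  hence "((\<lambda>t. ?g (- t)) has_real_derivative - partial j f x) (at 0)"
    using DERIV_mirror[where f = ?g and x = 0 and y = "partial j f x"] by simp
  hence "(?g has_real_derivative - partial j f x) (at 0)"
    using DERIV_cong_ev[OF refl assms(3) refl] by blast
  from DERIV_unique[OF d this] show ?thesis by simp
qed

lemma axis_in_ball: "t *\<^sub>R axis k 1 \<in> ball (0 :: real ^ 'n::finite) 1 \<longleftrightarrow> \<bar>t\<bar> < 1"
  by simp

context
  fixes w :: "real ^ 'n::finite \<Rightarrow> real"
  assumes C2: "Ck_on 2 w (ball 0 1)"
    and radial: "radially_symmetric_on (ball 0 1) w"
begin

lemma radial_eq: "x \<in> ball 0 1 \<Longrightarrow> norm x = norm y \<Longrightarrow> w x = w y"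
  using radial unfolding radially_symmetric_on_def by (metis mem_ball_0)

lemma partials: "has_partials_on w (ball 0 1)" "has_partials_on (partial j w) (ball 0 1)"
  using C2 by (auto simp: numeral_2_eq_2)

text \<open>
  Moving from \<open>x\<close> in direction \<open>i\<close> and from \<open>y\<close> in direction \<open>j\<close> changes the norms in the same
  way, because \<open>|x + t e|\<^sup>2\<close> depends only on \<open>|x|\<close>, on \<open>t\<close> and on the coordinate of \<open>x\<close> along
  \<open>e\<close>. This is the source of all the symmetries used below.
\<close>

lemma partial_radial_cong:
  assumes "x \<in> ball 0 1" "norm x = norm y" "x $ i = y $ j"
  shows "partial i w x = partial j w y"
proof (rule partial_cong, rule eventually_mono[OF eventually_line_in_open[OF open_ball assms(1)]])
  fix t assume "x + t *\<^sub>R axis i 1 \<in> ball 0 1"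
  thus "w (x + t *\<^sub>R axis i 1) = w (y + t *\<^sub>R axis j 1)"
  proof (rule radial_eq)
    have "(norm (x + t *\<^sub>R axis i 1))\<^sup>2 = (norm (y + t *\<^sub>R axis j 1))\<^sup>2"
      unfolding norm_add_axis_sq using assms by simp
    thus "norm (x + t *\<^sub>R axis i 1) = norm (y + t *\<^sub>R axis j 1)" by simp
  qed
qed

lemma partial_radial_zero:
  assumes "x \<in> ball 0 1" "x $ j = 0"
  shows "partial j w x = 0"
proof (rule partial_zero_if_even[OF partials(1) assms(1)],
    rule eventually_mono[OF eventually_line_in_open[OF open_ball assms(1)]])
  fix t assume t: "x + t *\<^sub>R axis j 1 \<in> ball 0 1"
  have "(norm (x + t *\<^sub>R axis j 1))\<^sup>2 = (norm (x + (- t) *\<^sub>R axis j 1))\<^sup>2"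
    unfolding norm_add_axis_sq using assms by simp
  hence "norm (x + t *\<^sub>R axis j 1) = norm (x + (- t) *\<^sub>R axis j 1)" by simp
  thus "w (x + (- t) *\<^sub>R axis j 1) = w (x + t *\<^sub>R axis j 1)"
    using radial_eq[OF t] by simp
qed

text \<open>
  If \<open>l\<close> is not the axis, \<open>partial l w\<close> already vanishes on the hyperplane of zero \<open>l\<close>-th
  coordinate, in which the \<open>j\<close>-direction lies. If \<open>l\<close> is the axis, \<open>partial l w\<close> is even in the
  \<open>j\<close>-direction.
\<close>

lemma mixed_partial_on_axis:
  assumes "\<bar>t\<bar> < 1" "j \<noteq> l"
  shows "partial j (partial l w) (t *\<^sub>R axis k 1) = 0"
proof -
  let ?x = "t *\<^sub>R axis k 1 :: real ^ 'n"
  have x: "?x \<in> ball 0 1" using assms(1) by (simp add: axis_in_ball)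
  note ev = eventually_line_in_open[OF open_ball x]
  show ?thesis
  proof (cases "l = k")
    case False
    have "\<forall>\<^sub>F s in nhds 0. partial l w (?x + s *\<^sub>R axis j 1) = (\<lambda>_. 0) (?x + s *\<^sub>R axis j 1)"
      by (rule eventually_mono[OF ev[of "axis j 1"]])
         (rule partial_radial_zero, use False assms(2) in \<open>auto simp: axis_def\<close>)
    hence "partial j (partial l w) ?x = partial j (\<lambda>_. 0) ?x" by (rule partial_cong)
    thus ?thesis by (simp add: partial_def)
  next
    case True
    show ?thesis
    proof (rule partial_zero_if_even[OF partials(2) x], rule eventually_mono[OF ev[of "axis j 1"]])
      fix s assume s: "?x + s *\<^sub>R axis j 1 \<in> ball 0 1"
      have xj: "?x $ j = 0" using True assms(2) by (simp add: axis_def)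
      have "(norm (?x + s *\<^sub>R axis j 1))\<^sup>2 = (norm (?x + (- s) *\<^sub>R axis j 1))\<^sup>2"
        unfolding norm_add_axis_sq xj by simp
      hence "norm (?x + s *\<^sub>R axis j 1) = norm (?x + (- s) *\<^sub>R axis j 1)" by simp
      thus "partial l w (?x + (- s) *\<^sub>R axis j 1) = partial l w (?x + s *\<^sub>R axis j 1)"
        using partial_radial_cong[OF s, of "?x + (- s) *\<^sub>R axis j 1" l l] assms(2)
        by (simp add: axis_def)
    qed
  qed
qed

lemma pure_partial_at_0: "partial j (partial j w) 0 = partial k (partial k w) 0"
proof (rule partial_cong, rule eventually_mono[OF eventually_line_in_open[of "ball 0 1" 0 "axis j 1"]])
  fix t assume "0 + t *\<^sub>R axis j 1 \<in> ball (0 :: real ^ 'n) 1"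
  thus "partial j w (0 + t *\<^sub>R axis j 1) = partial k w (0 + t *\<^sub>R axis k 1)"
    by (intro partial_radial_cong) (auto simp: axis_def norm_axis_1[unfolded axis_def])
qed auto

text \<open>
  With \<open>\<rho> s = sqrt (t\<^sup>2 + s\<^sup>2)\<close> and \<open>W\<close> the profile of \<open>w\<close>, the derivative of \<open>W (\<rho> s)\<close> is
  \<open>W'(\<rho> s) s / \<rho> s\<close>, and at \<open>s = 0\<close> only the derivative of the factor \<open>s / \<rho> s\<close> survives.
\<close>

lemma pure_partial_off_axis:
  assumes t: "0 < t" "t < 1" and "j \<noteq> k"
  shows "partial j (partial j w) (t *\<^sub>R axis k 1) = partial k w (t *\<^sub>R axis k 1) / t"
proof -
  let ?x = "t *\<^sub>R axis k 1 :: real ^ 'n"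
  define W1 where "W1 s = partial k w (s *\<^sub>R axis k 1)" for s
  define \<rho> where "\<rho> s = sqrt (t\<^sup>2 + s\<^sup>2)" for s
  have x: "?x \<in> ball 0 1" using t by (simp add: axis_in_ball)
  note ev = eventually_line_in_open[OF open_ball x, of "axis j 1"]
  have xj: "?x $ j = 0" using assms(3) by (simp add: axis_def)
  have norm_\<rho>: "norm (?x + s *\<^sub>R axis j 1) = \<rho> s" for s
  proof -
    have "(norm (?x + s *\<^sub>R axis j 1))\<^sup>2 = t\<^sup>2 + s\<^sup>2"
      unfolding norm_add_axis_sq xj by simp
    thus ?thesis unfolding \<rho>_def by (metis norm_ge_zero real_sqrt_unique)
  qed
  have pos: "t\<^sup>2 + s\<^sup>2 > 0" for s using t by (simp add: add_pos_nonneg)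
  have \<rho>_deriv: "(\<rho> has_real_derivative s / \<rho> s) (at s)" for s
    unfolding \<rho>_def using pos[of s]
    by (auto intro!: derivative_eq_intros simp: field_simps)
  have first: "partial j w (?x + s *\<^sub>R axis j 1) = W1 (\<rho> s) * (s / \<rho> s)"
    if s: "?x + s *\<^sub>R axis j 1 \<in> ball 0 1" for s
  proof -
    have \<rho>1: "\<rho> s *\<^sub>R axis k 1 \<in> ball (0 :: real ^ 'n) 1" using s norm_\<rho>[of s] norm_ge_zero[of "?x + s *\<^sub>R axis j 1"] by simp
    have "((\<lambda>r. w (r *\<^sub>R axis k 1)) has_real_derivative W1 (\<rho> s)) (at (\<rho> s))"
      unfolding W1_def by (rule has_partials_on_DERIV_axis[OF partials(1) \<rho>1])
    hence "((\<lambda>r. w (\<rho> r *\<^sub>R axis k 1)) has_real_derivative W1 (\<rho> s) * (s / \<rho> s)) (at s)"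
      by (rule DERIV_chain2) (rule \<rho>_deriv)
    moreover have "w (?x + r *\<^sub>R axis j 1) = w (\<rho> r *\<^sub>R axis k 1)"
      if "?x + r *\<^sub>R axis j 1 \<in> ball 0 1" for r
      by (rule radial_eq[OF that]) (use norm_\<rho>[of r] pos in \<open>simp add: \<rho>_def\<close>)
    moreover have "\<forall>\<^sub>F r in nhds s. ?x + r *\<^sub>R axis j 1 \<in> ball 0 1"
      by (rule eventually_nhds_line_in_open[OF open_ball s])
    ultimately have "((\<lambda>r. w (?x + r *\<^sub>R axis j 1)) has_real_derivative W1 (\<rho> s) * (s / \<rho> s)) (at s)"
      by (subst DERIV_cong_ev[OF refl _ refl]) (auto elim: eventually_mono)
    thus ?thesis
      using has_partials_on_DERIV_line[OF partials(1) s] DERIV_unique by blast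
  qed
  have \<rho>0: "\<rho> 0 = t" using t by (simp add: \<rho>_def)
  have "(W1 has_real_derivative partial k (partial k w) ?x) (at (\<rho> 0))"
    unfolding W1_def \<rho>0 by (rule has_partials_on_DERIV_axis[OF partials(2) x])
  hence d1: "((\<lambda>s. W1 (\<rho> s)) has_real_derivative partial k (partial k w) ?x * (0 / \<rho> 0)) (at 0)"
    by (rule DERIV_chain2) (rule \<rho>_deriv)
  have d2: "((\<lambda>s. s / \<rho> s) has_real_derivative 1 / t) (at 0)"
    using \<rho>0 t by (auto intro!: derivative_eq_intros \<rho>_deriv simp: field_simps)
  have "((\<lambda>s. W1 (\<rho> s) * (s / \<rho> s)) has_real_derivative W1 t / t) (at 0)"
    using DERIV_mult[OF d1 d2] \<rho>0 by simp
  hence "((\<lambda>s. partial j w (?x + s *\<^sub>R axis j 1)) has_real_derivative W1 t / t) (at 0)"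
    by (subst DERIV_cong_ev[OF refl eventually_mono[OF ev] refl]) (auto simp: first)
  thus ?thesis unfolding partial_def[of j "partial j w"] W1_def by (rule DERIV_imp_deriv)
qed

lemma two_derivs_on_axis:
  "two_derivs (\<lambda>t. w (t *\<^sub>R axis k 1)) (\<lambda>t. partial k w (t *\<^sub>R axis k 1))
     (\<lambda>t. partial k (partial k w) (t *\<^sub>R axis k 1)) {-1<..<1}"
  unfolding two_derivs_def
  by (intro ballI conjI has_partials_on_DERIV_axis[OF partials(1)] has_partials_on_DERIV_axis[OF partials(2)])
     auto

lemma even_on_axis: "\<bar>t\<bar> < 1 \<Longrightarrow> w (- t *\<^sub>R axis k 1) = w (t *\<^sub>R axis k 1)"
  by (rule radial_eq) auto

text \<open>
  At the origin the tangential second derivatives equal the axial one, so the trace joins the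
  leading coefficient; there the quotient by \<open>t = 0\<close> is \<open>0\<close> by convention, and its value is
  immaterial because the first derivative vanishes.
\<close>

lemma second_order_op_on_axis:
  fixes k :: 'n
  assumes t: "0 \<le> t" "t < 1"
  defines "x \<equiv> t *\<^sub>R axis k 1"
  shows "second_order_op a b c w x =
    (a k k x + (if t = 0 then \<Sum>j\<in>UNIV-{k}. a j j x else 0)) * partial k (partial k w) x
    + ((\<Sum>j\<in>UNIV-{k}. a j j x) / t + b k x) * partial k w x + c x * w x"
proof -
  have x: "x \<in> ball 0 1" using t by (simp add: x_def)
  define P where "P = (if t = 0 then partial k (partial k w) x else partial k w x / t)"
  have P: "partial j (partial j w) x = P" if "j \<noteq> k" for j
    unfolding P_def x_def
    using pure_partial_off_axis[OF _ t(2) that] pure_partial_at_0[of j k] t by (auto simp: less_le)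
  have "(\<Sum>l\<in>UNIV. a j l x * partial j (partial l w) x) = a j j x * partial j (partial j w) x" for j
  proof -
    have "(\<Sum>l\<in>UNIV. a j l x * partial j (partial l w) x)
        = (\<Sum>l\<in>UNIV. if l = j then a j j x * partial j (partial j w) x else 0)"
      by (rule sum.cong) (use t in \<open>auto simp: x_def mixed_partial_on_axis\<close>)
    thus ?thesis by simp
  qed
  hence "(\<Sum>j\<in>UNIV. \<Sum>l\<in>UNIV. a j l x * partial j (partial l w) x)
      = (\<Sum>j\<in>UNIV. a j j x * partial j (partial j w) x)" by simp
  also have "\<dots> = a k k x * partial k (partial k w) x + (\<Sum>j\<in>UNIV-{k}. a j j x * partial j (partial j w) x)"
    by (rule sum.remove) auto
  also have "(\<Sum>j\<in>UNIV-{k}. a j j x * partial j (partial j w) x) = (\<Sum>j\<in>UNIV-{k}. a j j x) * P"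
    unfolding sum_distrib_right by (rule sum.cong) (auto simp: P)
  finally have second: "(\<Sum>j\<in>UNIV. \<Sum>l\<in>UNIV. a j l x * partial j (partial l w) x)
      = a k k x * partial k (partial k w) x + (\<Sum>j\<in>UNIV-{k}. a j j x) * P" .
  have "(\<Sum>j\<in>UNIV. b j x * partial j w x) = (\<Sum>j\<in>UNIV. if j = k then b k x * partial k w x else 0)"
    by (rule sum.cong) (use partial_radial_zero[OF x] in \<open>auto simp: x_def axis_def\<close>)
  hence first: "(\<Sum>j\<in>UNIV. b j x * partial j w x) = b k x * partial k w x" by simp
  have zero: "partial k w x = 0" if "t = 0"
    using partial_radial_zero[OF x] that by (simp add: x_def)
  show ?thesis unfolding second_order_op_def second first P_def using zero
    by (auto simp: algebra_simps)
qed

end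

section \<open>The operator induced on radial profiles\<close>

text \<open>
  Testing ellipticity with coordinate vectors bounds every diagonal coefficient below by \<open>\<eta>\<close>;
  in particular the trace in front of \<open>W' / t\<close> is nonnegative.
\<close>

lemma radial_operator_on_axis:
  fixes a :: "'n::finite \<Rightarrow> 'n \<Rightarrow> real ^ 'n \<Rightarrow> real" and b :: "'n \<Rightarrow> real ^ 'n \<Rightarrow> real"
    and c :: "real ^ 'n \<Rightarrow> real"
  assumes a_bdd: "\<And>j l. bounded (a j l ` ball 0 1)"
    and b_bdd: "\<And>j. bounded (b j ` ball 0 1)"
    and c_bdd: "bounded (c ` ball 0 1)"
    and eta_pos: "\<eta> > 0"
    and elliptic: "\<And>x \<xi>. x \<in> ball 0 1 \<Longrightarrow>
           (\<Sum>j\<in>UNIV. \<Sum>l\<in>UNIV. a j l x * \<xi> $ j * \<xi> $ l) \<ge> \<eta> * (norm \<xi>)\<^sup>2"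
    and c_nonpos: "\<And>x. x \<in> ball 0 1 \<Longrightarrow> c x \<le> 0"
  obtains M where "radial_operator
     (\<lambda>t. a k k (t *\<^sub>R axis k 1) + (if t = 0 then \<Sum>j\<in>UNIV-{k}. a j j (t *\<^sub>R axis k 1) else 0))
     (\<lambda>t. (\<Sum>j\<in>UNIV-{k}. a j j (t *\<^sub>R axis k 1)) / t + b k (t *\<^sub>R axis k 1))
     (\<lambda>t. c (t *\<^sub>R axis k 1)) \<eta> M"
proof -
  have diag: "a j j x \<ge> \<eta>" if "x \<in> ball 0 1" for j x
  proof -
    have "(\<Sum>i\<in>UNIV. \<Sum>l\<in>UNIV. a i l x * axis j (1::real) $ i * axis j 1 $ l)
        = (\<Sum>i\<in>UNIV. \<Sum>l\<in>UNIV. if l = j then (if i = j then a j j x else 0) else 0)"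
      by (intro sum.cong refl) (auto simp: axis_def)
    also have "\<dots> = a j j x" by simp
    finally show ?thesis using elliptic[OF that, of "axis j 1"] by (simp add: norm_axis_1)
  qed
  have "\<forall>j. \<exists>K. \<forall>x\<in>ball 0 1. \<bar>a j j x\<bar> \<le> K" using a_bdd by (auto simp: bounded_iff)
  then obtain Ka where Ka: "\<And>j x. x \<in> ball 0 1 \<Longrightarrow> \<bar>a j j x\<bar> \<le> Ka j" by metis
  have "\<exists>K. \<forall>x\<in>ball 0 1. \<bar>b k x\<bar> \<le> K" using b_bdd[of k] by (simp add: bounded_iff)
  then obtain Kb where Kb: "\<And>x. x \<in> ball 0 1 \<Longrightarrow> \<bar>b k x\<bar> \<le> Kb" by metis
  have "\<exists>K. \<forall>x\<in>ball 0 1. \<bar>c x\<bar> \<le> K" using c_bdd by (simp add: bounded_iff)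
  then obtain Kc where Kc: "\<And>x. x \<in> ball 0 1 \<Longrightarrow> \<bar>c x\<bar> \<le> Kc" by metis
  define Ks where "Ks = (\<Sum>j\<in>UNIV-{k}. Ka j)"
  define M where "M = \<bar>Ks\<bar> + \<bar>Kb\<bar> + \<bar>Kc\<bar>"
  have S: "0 \<le> (\<Sum>j\<in>UNIV-{k}. a j j x)" "(\<Sum>j\<in>UNIV-{k}. a j j x) \<le> M" if x: "x \<in> ball 0 1" for x
  proof -
    show "0 \<le> (\<Sum>j\<in>UNIV-{k}. a j j x)"
      by (rule sum_nonneg) (use diag[OF x] eta_pos in \<open>meson less_imp_le order_trans\<close>)
    have "(\<Sum>j\<in>UNIV-{k}. a j j x) \<le> Ks"
      unfolding Ks_def by (rule sum_mono) (use Ka[OF x] in \<open>simp add: abs_le_iff\<close>)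
    thus "(\<Sum>j\<in>UNIV-{k}. a j j x) \<le> M" by (simp add: M_def)
  qed
  have bM: "\<bar>b k x\<bar> \<le> M" and cM: "\<bar>c x\<bar> \<le> M" if "x \<in> ball 0 1" for x :: "real ^ 'n"
    using Kb[OF that] Kc[OF that] by (auto simp: M_def)
  show thesis
  proof (rule that, unfold_locales)
    fix t :: real
    let ?x = "t *\<^sub>R axis k 1 :: real ^ 'n"
    let ?S = "\<Sum>j\<in>UNIV-{k}. a j j ?x"
    show "\<eta> > 0" by fact
    {
      assume t: "0 \<le> t" "t < 1"
      hence x: "?x \<in> ball 0 1" by simp
      show "\<eta> \<le> a k k ?x + (if t = 0 then ?S else 0)"
        using diag[OF x, of k] S(1)[OF x] by (auto intro: add_increasing2)
      have "?S / t \<ge> 0" using S(1)[OF x] t by simp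
      thus "- M \<le> ?S / t + b k ?x" using bM[OF x] by linarith
      show "- M \<le> c ?x" using cM[OF x] by linarith
      show "c ?x \<le> 0" using c_nonpos[OF x] .
    next
      assume t: "0 < t" "t < 1"
      hence x: "?x \<in> ball 0 1" by simp
      have "?S / t \<le> M / t" using S(2)[OF x] t by (intro divide_right_mono) auto
      thus "?S / t + b k ?x \<le> M + M / t" using bM[OF x] by linarith
    }
  qed
qed

theorem theorem1p4:
  fixes a :: "nat \<Rightarrow> 'n::finite \<Rightarrow> 'n \<Rightarrow> real ^ 'n \<Rightarrow> real"
    and b :: "nat \<Rightarrow> 'n \<Rightarrow> real ^ 'n \<Rightarrow> real"
    and c :: "nat \<Rightarrow> real ^ 'n \<Rightarrow> real"
    and \<eta> :: real
    and u \<gamma> :: "real ^ 'n \<Rightarrow> real"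
  assumes a_sym: "\<And>i j k x. i \<in> {1, 2} \<Longrightarrow> x \<in> ball 0 1 \<Longrightarrow> a i j k x = a i k j x"
    and a_bdd: "\<And>i j k. i \<in> {1, 2} \<Longrightarrow> bounded (a i j k ` ball 0 1)"
    and b_bdd: "\<And>i j. i \<in> {1, 2} \<Longrightarrow> bounded (b i j ` ball 0 1)"
    and c_bdd: "\<And>i. i \<in> {1, 2} \<Longrightarrow> bounded (c i ` ball 0 1)"
    and eta_pos: "\<eta> > 0"
    and elliptic: "\<And>i x \<xi>. i \<in> {1, 2} \<Longrightarrow> x \<in> ball 0 1 \<Longrightarrow>
           (\<Sum>j\<in>UNIV. \<Sum>k\<in>UNIV. a i j k x * \<xi> $ j * \<xi> $ k) \<ge> \<eta> * (norm \<xi>)\<^sup>2"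
    and c_nonpos: "\<And>i x. i \<in> {1, 2} \<Longrightarrow> x \<in> ball 0 1 \<Longrightarrow> c i x \<le> 0"
    and u_C4: "Ck_on 4 u (ball 0 1)"
    and u_C2_closure: "Ck_on_closure 2 u (ball 0 1)"
    and gamma_C2: "Ck_on 2 \<gamma> (ball 0 1)"
    and gamma_C0_closure: "Ck_on_closure 0 \<gamma> (ball 0 1)"
    and eq1: "\<And>x. x \<in> ball 0 1 \<Longrightarrow> second_order_op (a 1) (b 1) (c 1) u x = \<gamma> x"
    and ineq2: "\<And>x. x \<in> ball 0 1 \<Longrightarrow> second_order_op (a 2) (b 2) (c 2) \<gamma> x \<le> 0"
    and u_bdry: "\<And>x. x \<in> sphere 0 1 \<Longrightarrow> u x = 0"
    and normal_deriv_bdry: "\<And>x. x \<in> sphere 0 1 \<Longrightarrow> has_outward_derivative u 0 x x"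
    and u_radial: "radially_symmetric_on (cball 0 1) u"
    and gamma_radial: "radially_symmetric_on (cball 0 1) \<gamma>"
  shows "(\<forall>x\<in>ball 0 1. u x = 0) \<or> (\<forall>x\<in>ball 0 1. u x < 0)"
proof -
  \<comment> \<open>Any coordinate axis will do.\<close>
  define k :: 'n where "k = undefined"
  let ?e = "axis k 1 :: real ^ 'n"
  have u_C2: "Ck_on 2 u (ball 0 1)" using u_C4 by (auto simp: eval_nat_numeral)
  have u_rad: "radially_symmetric_on (ball 0 1) u" and gamma_rad: "radially_symmetric_on (ball 0 1) \<gamma>"
    using u_radial gamma_radial by (auto simp: radially_symmetric_on_def)
  note u_facts = u_C2 u_rad and gamma_facts = gamma_C2 gamma_rad
  define A where "A = (\<lambda>i t. a i k k (t *\<^sub>R ?e)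
    + (if t = 0 then \<Sum>j\<in>UNIV-{k}. a i j j (t *\<^sub>R ?e) else 0))"
  define D where "D = (\<lambda>i t. (\<Sum>j\<in>UNIV-{k}. a i j j (t *\<^sub>R ?e)) / t + b i k (t *\<^sub>R ?e))"
  define C where "C = (\<lambda>i t. c i (t *\<^sub>R ?e))"
  have "\<exists>M. radial_operator (A i) (D i) (C i) \<eta> M" if i: "i \<in> {1, 2}" for i
    unfolding A_def D_def C_def
    by (rule radial_operator_on_axis[of "a i" "b i" "c i" \<eta> k,
          OF a_bdd[OF i] b_bdd[OF i] c_bdd[OF i] eta_pos])
       (rule elliptic[OF i] c_nonpos[OF i] exI, assumption)+
  then obtain M1 M2 where op1: "radial_operator (A 1) (D 1) (C 1) \<eta> M1"
    and op2: "radial_operator (A 2) (D 2) (C 2) \<eta> M2" by blast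
  have on_axis: "A i t * partial k (partial k w) (t *\<^sub>R ?e) + D i t * partial k w (t *\<^sub>R ?e)
      + C i t * w (t *\<^sub>R ?e) = second_order_op (a i) (b i) (c i) w (t *\<^sub>R ?e)"
    if "Ck_on 2 w (ball 0 1)" "radially_symmetric_on (ball 0 1) w" "0 \<le> t" "t < 1" for i w t
    unfolding second_order_op_on_axis[OF that] A_def D_def C_def by (rule refl)
  have cont: "continuous_on {0..1} (\<lambda>t. u (t *\<^sub>R ?e))"
  proof (rule continuous_on_compose2[of "cball 0 1" u])
    show "continuous_on (cball 0 1) u" using u_C2_closure by (simp add: numeral_2_eq_2)
  qed (auto intro!: continuous_intros)
  have e: "?e \<in> sphere 0 1" by simp
  have normal: "((\<lambda>t. u (t *\<^sub>R ?e)) has_real_derivative 0) (at_left 1)"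
  proof -
    have "((\<lambda>t. u ((1 + t) *\<^sub>R ?e)) has_real_derivative 0) (at_left 0)"
      using normal_deriv_bdry[OF e] by (simp add: has_outward_derivative_def algebra_simps)
    hence "((\<lambda>t. u (t *\<^sub>R ?e)) has_real_derivative 0) (at (1 + 0) within ((+) 1 ` {..<0}))"
      by (subst DERIV_at_within_shift)
    moreover have "(+) 1 ` {..<0} = {..<1::real}" by (auto intro: image_eqI[of _ _ "_ - 1"])
    ultimately show ?thesis by simp
  qed
  have "(\<forall>t\<in>{0..<1}. u (t *\<^sub>R ?e) = 0) \<or> (\<forall>t\<in>{0..<1}. u (t *\<^sub>R ?e) < 0)"
  proof (rule radial_dichotomy[OF op1 op2 two_derivs_on_axis[OF u_facts] cont even_on_axis[OF u_facts]
        two_derivs_on_axis[OF gamma_facts] even_on_axis[OF gamma_facts] _ _ _ normal])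
    fix t :: real assume t: "0 \<le> t" "t < 1"
    hence x: "t *\<^sub>R ?e \<in> ball 0 1" by simp
    show "A 1 t * partial k (partial k u) (t *\<^sub>R ?e) + D 1 t * partial k u (t *\<^sub>R ?e)
        + C 1 t * u (t *\<^sub>R ?e) = \<gamma> (t *\<^sub>R ?e)"
      unfolding on_axis[OF u_facts t] by (rule eq1[OF x])
    show "A 2 t * partial k (partial k \<gamma>) (t *\<^sub>R ?e) + D 2 t * partial k \<gamma> (t *\<^sub>R ?e)
        + C 2 t * \<gamma> (t *\<^sub>R ?e) \<le> 0"
      unfolding on_axis[OF gamma_facts t] by (rule ineq2[OF x])
  qed (use u_bdry[OF e] in simp_all)
  moreover have "u x = u (norm x *\<^sub>R ?e)" "norm x \<in> {0..<1}" if "x \<in> ball 0 1" for x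
    using that radial_eq[OF u_facts that, of "norm x *\<^sub>R ?e"] by auto
  ultimately show ?thesis by metis
qed

end
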